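(* Let $n\geq 5$, let $R$ be an $n$-curvature operator, and let $\{K_1,\dots,K_{\binom n4}\}$ be a basis of the space of $4$-forms in dimension $n$. Put $$p(x,z_1,\dots,z_{\binom n4})=\det\Big(R-xI-\sum_{s=1}^{\binom n4}z_sK_s\Big),$$ and let $q(x)=\mathrm{disc}_z(p)$ be the multivariate discriminant of $p$ with respect to the variables $z_1,\dots,z_{\binom n4}$. Then $q(x)=0$ identically.
   Context: Work on $\mathbb{R}^n$ with its standard inner product. $\Lambda^2$ is the space of $2$-forms, of dimension $N=\frac{n(n-1)}2$, with $e_a\wedge e_b$ ($a<b$) orthonormal. An $n$-curvature operator is a Riemann curvature tensor $R_{abcd}$ in dimension $n$ (with the usual symmetries) regarded as a self-adjoint operator on $\Lambda^2$. $I$ is the identity on $\Lambda^2$. A $4$-form $W$ is regarded as the self-adjoint operator on $\Lambda^2$ given by $(Wv)_{ab}=\tfrac12\sum_{c,d}W_{abcd}v_{cd}$. The multivariate discriminant $\mathrm{disc}_z$ of polynomials of (formal) degree $N$ in $m=\binom n4$ variables $z_1,\dots,z_m$ is the irreducible polynomial expression (unique up to scalar) in the coefficients which vanishes exactly when the degree-$N$ homogenization of the polynomial (in $m+1$ variables) has a nontrivial complex point at which all its first partial derivatives vanish. In particular it vanishes whenever there is a complex point $z$ at which the polynomial and all its partial derivatives $\partial/\partial z_s$ vanish. Here it is applied to $p(x,\cdot)$, whose coefficients are polynomials in $x$. *)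

theory Defs
  imports
    Jordan_Normal_Form.Determinant
    "HOL-Library.Poly_Mapping"
    "HOL-Library.Function_Algebras"
begin

section \<open>Multivariate polynomials and their discriminant\<close>

text \<open>
  Multivariate polynomials are finitely supported functions from monomials (finitely supported
  exponent functions) to coefficients; multiplication is the convolution product of
  \<^theory>\<open>HOL-Library.Poly_Mapping\<close>.
\<close>

type_synonym 'v monomial = "'v \<Rightarrow>\<^sub>0 nat"
type_synonym ('v, 'a) mpolynomial = "'v monomial \<Rightarrow>\<^sub>0 'a"

definition mconst :: "'a::zero \<Rightarrow> ('v, 'a) mpolynomial" where
  "mconst c = Poly_Mapping.single 0 c"

definition mvar :: "'v \<Rightarrow> ('v, 'a::zero_neq_one) mpolynomial" where
  "mvar v = Poly_Mapping.single (Poly_Mapping.single v 1) 1"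

definition monomial_degree :: "'v monomial \<Rightarrow> nat" where
  "monomial_degree \<alpha> = (\<Sum>v\<in>Poly_Mapping.keys \<alpha>. Poly_Mapping.lookup \<alpha> v)"

definition monomial_value :: "('v \<Rightarrow> 'b::comm_semiring_1) \<Rightarrow> 'v monomial \<Rightarrow> 'b" where
  "monomial_value z \<alpha> = (\<Prod>v\<in>Poly_Mapping.keys \<alpha>. z v ^ Poly_Mapping.lookup \<alpha> v)"

text \<open>Evaluation at \<open>z\<close>, the coefficients being transported along \<open>h\<close>.\<close>

definition meval ::
  "('a::zero \<Rightarrow> 'b::comm_semiring_1) \<Rightarrow> ('v \<Rightarrow> 'b) \<Rightarrow> ('v, 'a) mpolynomial \<Rightarrow> 'b" where
  "meval h z P =
    (\<Sum>\<alpha>\<in>Poly_Mapping.keys P. h (Poly_Mapping.lookup P \<alpha>) * monomial_value z \<alpha>)"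

definition monomials_upto :: "nat \<Rightarrow> nat \<Rightarrow> nat monomial set" where
  "monomials_upto m N = {\<alpha>. Poly_Mapping.keys \<alpha> \<subseteq> {1..m} \<and> monomial_degree \<alpha> \<le> N}"

text \<open>
  The polynomial variables are \<open>z\<^sub>1, \<dots>, z\<^sub>m\<close>; the index \<open>0\<close> is reserved for the homogenizing
  variable. \<open>N\<close> is the formal degree, possibly larger than the actual degree.
\<close>

definition homogenization ::
  "nat \<Rightarrow> (nat, 'a::comm_monoid_add) mpolynomial \<Rightarrow> (nat, 'a) mpolynomial" where
  "homogenization N P =
    (\<Sum>\<alpha>\<in>Poly_Mapping.keys P.
       Poly_Mapping.single (\<alpha> + Poly_Mapping.single 0 (N - monomial_degree \<alpha>))
         (Poly_Mapping.lookup P \<alpha>))"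

definition has_singular_point :: "nat \<Rightarrow> (nat, complex) mpolynomial \<Rightarrow> bool" where
  "has_singular_point m F \<longleftrightarrow>
    (\<exists>z :: nat \<Rightarrow> complex. (\<exists>i\<in>{0..m}. z i \<noteq> 0) \<and>
       (\<forall>i\<in>{0..m}. ((\<lambda>t. meval id (z(i := t)) F) has_field_derivative 0) (at (z i))))"

text \<open>
  A discriminant is a polynomial \<open>D\<close> in the coefficients of the generic polynomial of formal
  degree \<open>N\<close> in \<open>m\<close> variables: the indeterminates of \<open>D\<close> are indexed by the monomials of degree
  at most \<open>N\<close>, and the indeterminate indexed by \<open>\<alpha>\<close> stands for the coefficient of \<open>\<alpha>\<close>. Since the
  defining property determines \<open>D\<close> only up to a scalar, it is stated as a predicate on \<open>D\<close>.
\<close>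

definition is_discriminant ::
  "nat \<Rightarrow> nat \<Rightarrow> (nat monomial, complex) mpolynomial \<Rightarrow> bool" where
  "is_discriminant m N D \<longleftrightarrow>
     (\<forall>\<mu>\<in>Poly_Mapping.keys D. Poly_Mapping.keys \<mu> \<subseteq> monomials_upto m N) \<and>
     irreducible D \<and>
     (\<forall>P :: (nat, complex) mpolynomial. Poly_Mapping.keys P \<subseteq> monomials_upto m N \<longrightarrow>
        (meval id (Poly_Mapping.lookup P) D = 0 \<longleftrightarrow>
         has_singular_point m (homogenization N P)))"

text \<open>
  The discriminant of a polynomial in \<open>z\<^sub>1, \<dots>, z\<^sub>m\<close> whose coefficients are polynomials in a
  further variable \<open>x\<close>; the result is a polynomial in \<open>x\<close>.
\<close>

definition disc_z ::
  "(nat monomial, complex) mpolynomial \<Rightarrow> (nat, complex poly) mpolynomial \<Rightarrow> complex poly" where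
  "disc_z D P = meval (\<lambda>c. [:c:]) (Poly_Mapping.lookup P) D"


section \<open>Curvature operators and 4-forms\<close>

text \<open>
  Tensors on \<open>\<real>\<^sup>n\<close> are given by their components in the standard basis, with indices in
  \<open>{..<n}\<close>. Components with an index outside this range are required to be \<open>0\<close>, so that equality
  of functions is equality of tensors.
\<close>

type_synonym tensor4 = "nat \<Rightarrow> nat \<Rightarrow> nat \<Rightarrow> nat \<Rightarrow> real"

definition tensor4_on :: "nat \<Rightarrow> tensor4 \<Rightarrow> bool" where
  "tensor4_on n T \<longleftrightarrow>
    (\<forall>a b c d. T a b c d \<noteq> 0 \<longrightarrow> a < n \<and> b < n \<and> c < n \<and> d < n)"

definition curvature_tensor :: "nat \<Rightarrow> tensor4 \<Rightarrow> bool" where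
  "curvature_tensor n R \<longleftrightarrow> tensor4_on n R \<and>
    (\<forall>a b c d. R b a c d = - R a b c d \<and> R a b d c = - R a b c d \<and> R c d a b = R a b c d \<and>
       R a b c d + R a c d b + R a d b c = 0)"

definition four_forms :: "nat \<Rightarrow> tensor4 set" where
  "four_forms n = {W. tensor4_on n W \<and>
    (\<forall>a b c d. W b a c d = - W a b c d \<and> W a c b d = - W a b c d \<and> W a b d c = - W a b c d)}"

interpretation tensor: vector_space "\<lambda>(r::real) (T::tensor4) a b c d. r * T a b c d"
  by unfold_locales (auto simp: fun_eq_iff algebra_simps)

definition four_form_basis :: "nat \<Rightarrow> (nat \<Rightarrow> tensor4) \<Rightarrow> bool" where
  "four_form_basis n K \<longleftrightarrow>
    inj_on K {1..n choose 4} \<and>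
    tensor.independent (K ` {1..n choose 4}) \<and>
    tensor.span (K ` {1..n choose 4}) = four_forms n"

definition operator_of :: "nat \<Rightarrow> tensor4 \<Rightarrow> (nat \<Rightarrow> nat \<Rightarrow> real) \<Rightarrow> nat \<Rightarrow> nat \<Rightarrow> real" where
  "operator_of n T v a b = (1/2) * (\<Sum>c<n. \<Sum>d<n. T a b c d * v c d)"

definition wedge_basis :: "nat \<times> nat \<Rightarrow> nat \<Rightarrow> nat \<Rightarrow> real" where
  "wedge_basis = (\<lambda>(a, b) c d. of_bool (a = c \<and> b = d) - of_bool (a = d \<and> b = c))"

definition index_pairs :: "nat \<Rightarrow> (nat \<times> nat) list" where
  "index_pairs n = concat (map (\<lambda>b. map (\<lambda>a. (a, b)) [0..<b]) [0..<n])"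

definition dim2 :: "nat \<Rightarrow> nat" where
  "dim2 n = n * (n - 1) div 2"

lemma length_index_pairs: "length (index_pairs n) = dim2 n"
proof -
  have "length (index_pairs n) = n choose 2"
    by (induction n) (auto simp: index_pairs_def numeral_2_eq_2)
  then show ?thesis
    by (simp add: dim2_def choose_two)
qed

lemma set_index_pairs: "set (index_pairs n) = {(a, b). a < b \<and> b < n}"
  by (auto simp: index_pairs_def)

lemma distinct_index_pairs: "distinct (index_pairs n)"
  by (induction n) (auto simp: index_pairs_def distinct_map inj_on_def)

text \<open>
  The matrix of the operator of \<open>T\<close> in the orthonormal basis \<open>e\<^sub>a \<and> e\<^sub>b\<close> (\<open>a < b\<close>) of the 2-forms;
  the coefficient of \<open>e\<^sub>a \<and> e\<^sub>b\<close> in a 2-form \<open>v\<close> is the component \<open>v\<^sub>a\<^sub>b\<close>.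
\<close>

definition operator_matrix :: "nat \<Rightarrow> tensor4 \<Rightarrow> real mat" where
  "operator_matrix n T = mat (dim2 n) (dim2 n)
    (\<lambda>(i, j). case index_pairs n ! i of
       (a, b) \<Rightarrow> operator_of n T (wedge_basis (index_pairs n ! j)) a b)"

lemma operator_matrix_entry:
  assumes "T \<in> four_forms n \<or> curvature_tensor n T" "i < dim2 n" "j < dim2 n"
    and "index_pairs n ! i = (a, b)" "index_pairs n ! j = (c, d)"
  shows "operator_matrix n T $$ (i, j) = T a b c d"
proof -
  have cd: "c < n" "d < n"
    using assms nth_mem[of j "index_pairs n"] by (auto simp: length_index_pairs set_index_pairs)
  have anti: "T a b d c = - T a b c d"
    using assms(1) unfolding four_forms_def curvature_tensor_def by blast
  have "(\<Sum>k<n. \<Sum>l<n. T a b k l * wedge_basis (c, d) k l)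
      = (\<Sum>k<n. \<Sum>l<n. (if c = k then (if d = l then T a b k l else 0) else 0))
      - (\<Sum>k<n. \<Sum>l<n. (if d = k then (if c = l then T a b k l else 0) else 0))"
    unfolding sum_subtractf[symmetric] by (intro sum.cong refl) (auto simp: wedge_basis_def)
  also have "\<dots> = T a b c d - T a b d c"
  proof -
    have "(\<Sum>l<n. (if P then f l else 0)) = (if P then \<Sum>l<n. f l else 0)" for P and f :: "nat \<Rightarrow> real"
      by simp
    then show ?thesis using cd by (simp add: sum.delta)
  qed
  finally show ?thesis
    using assms(2-5) anti by (simp add: operator_matrix_def operator_of_def)
qed

text \<open>
  The following matrices have entries in \<open>\<complex>[x][z\<^sub>1, z\<^sub>2, \<dots>]\<close>: real scalars, the variable \<open>x\<close> and
  the variables \<open>z\<^sub>s\<close> are all embedded there.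
\<close>

definition scalar_mpoly :: "real \<Rightarrow> (nat, complex poly) mpolynomial" where
  "scalar_mpoly r = mconst [:complex_of_real r:]"

definition x_mpoly :: "(nat, complex poly) mpolynomial" where
  "x_mpoly = mconst [:0, 1:]"

definition p_poly :: "nat \<Rightarrow> tensor4 \<Rightarrow> (nat \<Rightarrow> tensor4) \<Rightarrow> (nat, complex poly) mpolynomial" where
  "p_poly n R K = det (mat (dim2 n) (dim2 n)
    (\<lambda>(i, j). scalar_mpoly (operator_matrix n R $$ (i, j))
       - x_mpoly * scalar_mpoly (1\<^sub>m (dim2 n) $$ (i, j))
       - (\<Sum>s\<in>{1..n choose 4}. mvar s * scalar_mpoly (operator_matrix n (K s) $$ (i, j)))))"

end

theory Submission
  imports Defs
begin

text \<open>
  The discriminant vanishes because the homogenization of \<open>p(x, \<cdot>)\<close> has a singular point at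
  infinity, and the same one for every \<open>x\<close>. The homogenization is the determinant of
  \<open>z\<^sub>0 (R - x I) - \<Sum>\<^sub>s z\<^sub>s K\<^sub>s\<close>. On the hyperplane \<open>z\<^sub>0 = 0\<close> at infinity both \<open>R\<close> and \<open>x\<close>
  disappear, and only the 4-form \<open>W = \<Sum>\<^sub>s z\<^sub>s K\<^sub>s\<close> is left. A determinant is singular at every
  matrix of corank at least two, so any nonzero 4-form \<open>W\<close> whose operator on 2-forms has a kernel
  of dimension at least two gives a singular point. In dimension four the operator of a nonzero
  4-form is invertible, but from dimension five on there is room for a vector \<open>e\<close> orthogonal to
  the four directions of a decomposable 4-form, and the operator kills \<open>v \<and> e\<close> for every \<open>v\<close>.
  With \<open>W\<close> a multiple of \<open>e\<^sub>0 \<and> e\<^sub>1 \<and> e\<^sub>2 \<and> e\<^sub>3\<close> (indices start at 0) this concerns all the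
  \<open>e\<^sub>a \<and> e\<^sub>4\<close>; two of them suffice, and they show up as two zero rows of the matrix, which makes
  the derivative of the determinant in every direction vanish
  (\<open>has_field_derivative_det_two_zero_rows\<close>, \<open>p_poly_singular_point\<close>).

  The discriminant property then gives \<open>q(x) = 0\<close> for each complex number \<open>x\<close>, because taking
  the discriminant commutes with specializing \<open>x\<close> (\<open>poly_disc_z\<close>), and a complex polynomial
  vanishing everywhere is zero.

  The identification of the homogenization with the homogeneous determinant
  (\<open>meval_homogenization_p_poly\<close>) rests on evaluation being a ring homomorphism and on the
  determinant having degree at most its size. For \<open>z\<^sub>0 \<noteq> 0\<close> it is the usual dehomogenization by
  \<open>z \<mapsto> z / z\<^sub>0\<close>; the points at infinity, where the argument takes place, follow by continuity
  in \<open>z\<^sub>0\<close>.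
\<close>

section \<open>Evaluation of multivariate polynomials\<close>

lemma monomial_value_superset:
  assumes "finite S" "Poly_Mapping.keys \<alpha> \<subseteq> S"
  shows "monomial_value z \<alpha> = (\<Prod>v\<in>S. z v ^ Poly_Mapping.lookup \<alpha> v)"
  unfolding monomial_value_def
  by (rule prod.mono_neutral_left) (use assms in \<open>auto simp: in_keys_iff\<close>)

lemma monomial_degree_superset:
  assumes "finite S" "Poly_Mapping.keys \<alpha> \<subseteq> S"
  shows "monomial_degree \<alpha> = (\<Sum>v\<in>S. Poly_Mapping.lookup \<alpha> v)"
  unfolding monomial_degree_def
  by (rule sum.mono_neutral_left) (use assms in \<open>auto simp: in_keys_iff\<close>)

lemma monomial_value_add: "monomial_value z (\<alpha> + \<beta>) = monomial_value z \<alpha> * monomial_value z \<beta>"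
proof -
  let ?S = "Poly_Mapping.keys \<alpha> \<union> Poly_Mapping.keys \<beta>"
  have "Poly_Mapping.keys (\<alpha> + \<beta>) \<subseteq> ?S"
    by (rule Poly_Mapping.keys_add)
  then show ?thesis
    by (simp add: monomial_value_superset[of ?S] lookup_add power_add prod.distrib)
qed

lemma monomial_degree_add: "monomial_degree (\<alpha> + \<beta>) = monomial_degree \<alpha> + monomial_degree \<beta>"
proof -
  let ?S = "Poly_Mapping.keys \<alpha> \<union> Poly_Mapping.keys \<beta>"
  have "Poly_Mapping.keys (\<alpha> + \<beta>) \<subseteq> ?S"
    by (rule Poly_Mapping.keys_add)
  then show ?thesis
    by (simp add: monomial_degree_superset[of ?S] lookup_add sum.distrib)
qed

lemma monomial_value_zero [simp]: "monomial_value z 0 = 1"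
  by (simp add: monomial_value_def)

lemma monomial_value_single [simp]: "monomial_value z (Poly_Mapping.single v k) = z v ^ k"
  by (simp add: monomial_value_def)

lemma monomial_value_scale:
  "monomial_value (\<lambda>v. c * z v) \<alpha> = c ^ monomial_degree \<alpha> * monomial_value z \<alpha>"
  by (simp add: monomial_value_def monomial_degree_def power_mult_distrib prod.distrib power_sum)

lemma meval_superset:
  assumes "finite S" "Poly_Mapping.keys P \<subseteq> S" "h 0 = 0"
  shows "meval h z P = (\<Sum>\<alpha>\<in>S. h (Poly_Mapping.lookup P \<alpha>) * monomial_value z \<alpha>)"
  unfolding meval_def
  by (rule sum.mono_neutral_left) (use assms in \<open>auto simp: in_keys_iff\<close>)

context comm_ring_hom
begin

lemma meval_add: "meval hom z (P + Q) = meval hom z P + meval hom z Q"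
proof -
  let ?S = "Poly_Mapping.keys P \<union> Poly_Mapping.keys Q"
  have "Poly_Mapping.keys (P + Q) \<subseteq> ?S"
    by (rule Poly_Mapping.keys_add)
  then show ?thesis
    by (simp add: meval_superset[of ?S] lookup_add hom_add algebra_simps sum.distrib)
qed

lemma meval_single: "meval hom z (Poly_Mapping.single \<alpha> c) = hom c * monomial_value z \<alpha>"
  by (simp add: meval_def)

lemma meval_sum: "meval hom z (sum P I) = (\<Sum>i\<in>I. meval hom z (P i))"
  by (induction I rule: infinite_finite_induct) (simp_all add: meval_add meval_def[of _ _ 0])

end

lemma sum_of_terms:
  "(\<Sum>\<alpha>\<in>Poly_Mapping.keys P. Poly_Mapping.single \<alpha> (Poly_Mapping.lookup P \<alpha>)) = P"
  by (rule poly_mapping_eqI) (simp add: lookup_sum lookup_single when_def in_keys_iff)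

lemma (in comm_ring_hom) meval_mult: "meval hom z (P * Q) = meval hom z P * meval hom z Q"
proof -
  let ?c = "Poly_Mapping.lookup P" and ?d = "Poly_Mapping.lookup Q"
  have "P * Q = (\<Sum>\<alpha>\<in>Poly_Mapping.keys P. Poly_Mapping.single \<alpha> (?c \<alpha>))
      * (\<Sum>\<beta>\<in>Poly_Mapping.keys Q. Poly_Mapping.single \<beta> (?d \<beta>))"
    by (simp only: sum_of_terms)
  also have "\<dots> = (\<Sum>\<alpha>\<in>Poly_Mapping.keys P. \<Sum>\<beta>\<in>Poly_Mapping.keys Q.
      Poly_Mapping.single (\<alpha> + \<beta>) (?c \<alpha> * ?d \<beta>))"
    by (simp add: sum_product mult_single)
  finally have "meval hom z (P * Q) = (\<Sum>\<alpha>\<in>Poly_Mapping.keys P. \<Sum>\<beta>\<in>Poly_Mapping.keys Q.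
      (hom (?c \<alpha>) * monomial_value z \<alpha>) * (hom (?d \<beta>) * monomial_value z \<beta>))"
    by (simp add: meval_sum meval_single monomial_value_add hom_mult mult_ac)
  then show ?thesis
    by (simp add: meval_def[of hom] sum_product)
qed

text \<open>Packaging evaluation as a homomorphism lets it be exchanged with determinants.\<close>

lemma (in comm_ring_hom) comm_ring_hom_meval: "comm_ring_hom (meval hom z)"
proof
  show "meval hom z 1 = 1"
    using meval_single[of z 0 1] by simp
qed (simp_all add: meval_add meval_mult meval_def[of _ _ 0])

lemma lookup_map_mpolynomial:
  assumes "f 0 = 0"
  shows "Poly_Mapping.lookup (Poly_Mapping.map f P) \<alpha> = f (Poly_Mapping.lookup P \<alpha>)"
  using assms by (simp add: Poly_Mapping.map.rep_eq when_def)

lemma keys_map_mpolynomial_subset: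
  "Poly_Mapping.keys (Poly_Mapping.map f P) \<subseteq> Poly_Mapping.keys P"
  by (auto simp: in_keys_iff Poly_Mapping.map.rep_eq)

lemma (in comm_ring_hom) meval_map: "meval id z (Poly_Mapping.map hom P) = meval hom z P"
  using keys_map_mpolynomial_subset[of hom P]
  by (simp add: meval_superset[of "Poly_Mapping.keys P"] lookup_map_mpolynomial)

lemma comm_ring_hom_poly_at: "comm_ring_hom (\<lambda>c. poly c x)"
  by unfold_locales auto

text \<open>
  Both sides insert coefficients into the polynomial \<open>D\<close>, and evaluation at \<open>x\<close> is a
  homomorphism. It reduces a statement on \<open>\<complex>[x]\<close> to one for each complex number \<open>x\<close>, where
  the defining property of a discriminant applies.
\<close>

lemma poly_disc_z:
  "poly (disc_z D P) x =
    meval id (Poly_Mapping.lookup (Poly_Mapping.map (\<lambda>c. poly c x) P)) D"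
  by (simp add: disc_z_def meval_def monomial_value_def poly_sum poly_prod poly_power
      lookup_map_mpolynomial)


section \<open>Degree bounds\<close>

lemma keys_add_monomials_upto:
  assumes "Poly_Mapping.keys P \<subseteq> monomials_upto m d" "Poly_Mapping.keys Q \<subseteq> monomials_upto m d"
  shows "Poly_Mapping.keys (P + Q) \<subseteq> monomials_upto m d"
  using assms Poly_Mapping.keys_add[of P Q] by blast

lemma keys_diff_monomials_upto:
  fixes P Q :: "(nat, 'a::comm_ring_1) mpolynomial"
  assumes "Poly_Mapping.keys P \<subseteq> monomials_upto m d" "Poly_Mapping.keys Q \<subseteq> monomials_upto m d"
  shows "Poly_Mapping.keys (P - Q) \<subseteq> monomials_upto m d"
proof
  fix \<alpha> assume "\<alpha> \<in> Poly_Mapping.keys (P - Q)"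
  then have "\<alpha> \<in> Poly_Mapping.keys P \<or> \<alpha> \<in> Poly_Mapping.keys Q"
    by (auto simp: in_keys_iff lookup_minus)
  then show "\<alpha> \<in> monomials_upto m d"
    using assms by blast
qed

lemma keys_sum_monomials_upto:
  assumes "\<And>i. i \<in> I \<Longrightarrow> Poly_Mapping.keys (P i) \<subseteq> monomials_upto m d"
  shows "Poly_Mapping.keys (sum P I) \<subseteq> monomials_upto m d"
  using assms
  by (induction I rule: infinite_finite_induct) (simp_all add: keys_add_monomials_upto)

lemma add_monomials_upto:
  assumes "\<alpha> \<in> monomials_upto m d" "\<beta> \<in> monomials_upto m e"
  shows "\<alpha> + \<beta> \<in> monomials_upto m (d + e)"
  using assms Poly_Mapping.keys_add[of \<alpha> \<beta>]
  by (auto simp: monomials_upto_def monomial_degree_add)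

lemma keys_mult_monomials_upto:
  assumes "Poly_Mapping.keys P \<subseteq> monomials_upto m d" "Poly_Mapping.keys Q \<subseteq> monomials_upto m e"
  shows "Poly_Mapping.keys (P * Q) \<subseteq> monomials_upto m (d + e)"
  using assms Poly_Mapping.keys_mult[of P Q] add_monomials_upto by fast

lemma zero_in_monomials_upto: "0 \<in> monomials_upto m d"
  by (simp add: monomials_upto_def monomial_degree_def)

lemma keys_prod_monomials_upto:
  fixes P :: "'i \<Rightarrow> (nat, 'a::comm_ring_1) mpolynomial"
  assumes "\<And>i. i \<in> I \<Longrightarrow> Poly_Mapping.keys (P i) \<subseteq> monomials_upto m 1"
  shows "Poly_Mapping.keys (prod P I) \<subseteq> monomials_upto m (card I)"
  using assms
proof (induction I rule: infinite_finite_induct)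
  case (insert i I)
  then show ?case
    using keys_mult_monomials_upto[of "P i" m 1 "prod P I" "card I"] by simp
qed (simp_all add: zero_in_monomials_upto)

text \<open>
  Each term of the Leibniz formula has one factor, of degree at most 1, from each of the \<open>N\<close> rows.
\<close>

lemma keys_det_monomials_upto:
  fixes A :: "(nat, 'a::comm_ring_1) mpolynomial mat"
  assumes A: "A \<in> carrier_mat N N"
    and entries: "\<And>i j. i < N \<Longrightarrow> j < N \<Longrightarrow> Poly_Mapping.keys (A $$ (i, j)) \<subseteq> monomials_upto m 1"
  shows "Poly_Mapping.keys (det A) \<subseteq> monomials_upto m N"
  unfolding det_def'[OF A]
proof (rule keys_sum_monomials_upto)
  fix p assume "p \<in> {p. p permutes {0..<N}}"
  then have "p i < N" if "i < N" for i
    using that permutes_in_image[of p "{0..<N}" i] by simp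
  then have "Poly_Mapping.keys (\<Prod>i = 0..<N. A $$ (i, p i)) \<subseteq> monomials_upto m N"
    using keys_prod_monomials_upto[of "{0..<N}" "\<lambda>i. A $$ (i, p i)" m] entries by simp
  then show "Poly_Mapping.keys (signof p * (\<Prod>i = 0..<N. A $$ (i, p i))) \<subseteq> monomials_upto m N"
    by (auto simp: sign_def in_keys_iff)
qed


section \<open>Homogenization\<close>

lemma meval_homogenization:
  fixes P :: "(nat, 'a::comm_ring_1) mpolynomial"
  shows "meval id z (homogenization N P) =
    (\<Sum>\<alpha>\<in>Poly_Mapping.keys P.
       Poly_Mapping.lookup P \<alpha> * (monomial_value z \<alpha> * z 0 ^ (N - monomial_degree \<alpha>)))"
proof -
  interpret comm_ring_hom "id :: 'a \<Rightarrow> 'a"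
    by unfold_locales auto
  show ?thesis
    by (simp add: homogenization_def meval_sum meval_single monomial_value_add)
qed

lemma meval_homogenization_off_infinity:
  fixes P :: "(nat, 'a::field) mpolynomial"
  assumes deg: "\<And>\<alpha>. \<alpha> \<in> Poly_Mapping.keys P \<Longrightarrow> monomial_degree \<alpha> \<le> N" and z0: "z 0 \<noteq> 0"
  shows "meval id z (homogenization N P) = z 0 ^ N * meval id (\<lambda>v. z v / z 0) P"
proof -
  have "monomial_value z \<alpha> * z 0 ^ (N - monomial_degree \<alpha>)
      = z 0 ^ N * monomial_value (\<lambda>v. z v / z 0) \<alpha>" if "\<alpha> \<in> Poly_Mapping.keys P" for \<alpha>
  proof -
    have "monomial_value z \<alpha> = z 0 ^ monomial_degree \<alpha> * monomial_value (\<lambda>v. z v / z 0) \<alpha>"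
      using monomial_value_scale[of "z 0" "\<lambda>v. z v / z 0" \<alpha>] z0 by simp
    then have "monomial_value z \<alpha> * z 0 ^ (N - monomial_degree \<alpha>)
        = (z 0 ^ monomial_degree \<alpha> * z 0 ^ (N - monomial_degree \<alpha>))
          * monomial_value (\<lambda>v. z v / z 0) \<alpha>"
      by simp
    then show ?thesis
      using deg[OF that] by (simp flip: power_add)
  qed
  then show ?thesis
    unfolding meval_homogenization meval_def[of id _ P]
    by (simp add: sum_distrib_left mult_ac)
qed

text \<open>
  The homogenization at a point with \<open>z\<^sub>0 = 0\<close> is reached as a limit, which takes continuity in
  the single coordinate \<open>z\<^sub>0\<close>.
\<close>

lemma isCont_monomial_value_update:
  fixes z :: "'v \<Rightarrow> complex"
  shows "isCont (\<lambda>t. monomial_value (z(v := t)) \<alpha>) t\<^sub>0"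
proof -
  have "isCont (\<lambda>t. (z(v := t)) u) t\<^sub>0" for u
    by (cases "u = v") simp_all
  then show ?thesis
    unfolding monomial_value_def by (intro continuous_intros)
qed

lemma isCont_meval_homogenization:
  fixes P :: "(nat, complex) mpolynomial"
  shows "isCont (\<lambda>t. meval id (z(0 := t)) (homogenization N P)) t\<^sub>0"
  unfolding meval_homogenization
  by (intro continuous_intros isCont_monomial_value_update) simp


section \<open>Determinants depending on a complex parameter\<close>

lemma isCont_det:
  fixes G :: "complex \<Rightarrow> complex mat"
  assumes G: "\<And>t. G t \<in> carrier_mat N N"
    and entries: "\<And>i j. i < N \<Longrightarrow> j < N \<Longrightarrow> isCont (\<lambda>t. G t $$ (i, j)) t\<^sub>0"
  shows "isCont (\<lambda>t. det (G t)) t\<^sub>0"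
proof -
  have "isCont (\<lambda>t. \<Prod>i = 0..<N. G t $$ (i, p i)) t\<^sub>0" if "p permutes {0..<N}" for p
  proof (rule continuous_prod, rule entries)
    fix i assume "i \<in> {0..<N}"
    then show "i < N" "p i < N"
      using permutes_in_image[OF that, of i] by simp_all
  qed
  then show ?thesis
    unfolding det_def'[OF G] by (intro continuous_sum continuous_mult continuous_const) simp
qed

text \<open>
  At the parameter \<open>t\<^sub>0\<close> each term of the Leibniz formula has two vanishing factors, one from row
  \<open>r\<close> and one from row \<open>s\<close>, and so vanishes there to second order. This is the form in which
  a kernel of dimension two makes the determinant singular.
\<close>

lemma has_field_derivative_det_two_zero_rows:
  fixes G :: "complex \<Rightarrow> complex mat"
  assumes G: "\<And>t. G t \<in> carrier_mat N N"
    and entries: "\<And>i j. i < N \<Longrightarrow> j < N \<Longrightarrow>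
      ((\<lambda>t. G t $$ (i, j)) has_field_derivative G' i j) (at t\<^sub>0)"
    and rows: "r < N" "s < N" "r \<noteq> s"
    and zero: "\<And>j. j < N \<Longrightarrow> G t\<^sub>0 $$ (r, j) = 0" "\<And>j. j < N \<Longrightarrow> G t\<^sub>0 $$ (s, j) = 0"
  shows "((\<lambda>t. det (G t)) has_field_derivative 0) (at t\<^sub>0)"
proof -
  have prod0: "((\<lambda>t. \<Prod>i = 0..<N. G t $$ (i, p i)) has_field_derivative 0) (at t\<^sub>0)"
    if p: "p permutes {0..<N}" for p
  proof -
    have p_less: "p i < N" if "i < N" for i
      using that permutes_in_image[OF p, of i] by simp
    have "((\<lambda>t. \<Prod>i = 0..<N. G t $$ (i, p i)) has_field_derivative
        (\<Sum>i = 0..<N. G' i (p i) * (\<Prod>k\<in>{0..<N} - {i}. G t\<^sub>0 $$ (k, p k)))) (at t\<^sub>0)"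
      by (rule has_field_derivative_prod) (simp add: entries p_less)
    \<comment> \<open>Removing one factor leaves a factor from row \<open>r\<close> or from row \<open>s\<close>.\<close>
    moreover have "(\<Prod>k\<in>{0..<N} - {i}. G t\<^sub>0 $$ (k, p k)) = 0" for i
    proof (cases "i = r")
      case True
      then have "s \<in> {0..<N} - {i}" "G t\<^sub>0 $$ (s, p s) = 0"
        using rows zero p_less by auto
      then show ?thesis by (meson finite_Diff finite_atLeastLessThan prod_zero)
    next
      case False
      then have "r \<in> {0..<N} - {i}" "G t\<^sub>0 $$ (r, p r) = 0"
        using rows zero p_less by auto
      then show ?thesis by (meson finite_Diff finite_atLeastLessThan prod_zero)
    qed
    ultimately show ?thesis by simp
  qed
  have "((\<lambda>t. \<Sum>p\<in>{p. p permutes {0..<N}}. signof p * (\<Prod>i = 0..<N. G t $$ (i, p i)))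
      has_field_derivative (\<Sum>p\<in>{p. p permutes {0..<N}}. signof p * 0)) (at t\<^sub>0)"
    by (intro DERIV_sum DERIV_cmult prod0) simp
  then show ?thesis
    by (simp add: det_def'[OF G])
qed


section \<open>The homogenized characteristic polynomial\<close>

text \<open>
  The matrix \<open>z\<^sub>0 (R - x I) - \<Sum>\<^sub>s z\<^sub>s K\<^sub>s\<close>: the matrix defining \<^const>\<open>p_poly\<close>, made homogeneous
  of degree one in \<open>z\<close>, with complex numbers in place of the variables.
\<close>

definition hom_pencil ::
  "nat \<Rightarrow> tensor4 \<Rightarrow> (nat \<Rightarrow> tensor4) \<Rightarrow> complex \<Rightarrow> (nat \<Rightarrow> complex) \<Rightarrow> complex mat" where
  "hom_pencil n R K x z = mat (dim2 n) (dim2 n) (\<lambda>(i, j).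
     z 0 * (complex_of_real (operator_matrix n R $$ (i, j)) - x * 1\<^sub>m (dim2 n) $$ (i, j))
       - (\<Sum>s\<in>{1..n choose 4}. z s * complex_of_real (operator_matrix n (K s) $$ (i, j))))"

lemma hom_pencil_carrier: "hom_pencil n R K x z \<in> carrier_mat (dim2 n) (dim2 n)"
  by (simp add: hom_pencil_def)

lemma monomials_upto_single: "v \<in> {1..m} \<Longrightarrow> Poly_Mapping.single v 1 \<in> monomials_upto m 1"
  by (simp add: monomials_upto_def monomial_degree_def)

lemma keys_mconst_monomials_upto: "Poly_Mapping.keys (mconst c) \<subseteq> monomials_upto m d"
  by (simp add: mconst_def zero_in_monomials_upto)

lemma keys_mvar_monomials_upto:
  "v \<in> {1..m} \<Longrightarrow>
    Poly_Mapping.keys (mvar v :: (nat, 'a::zero_neq_one) mpolynomial) \<subseteq> monomials_upto m 1"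
  by (simp add: mvar_def monomials_upto_single del: One_nat_def)

lemma keys_p_poly: "Poly_Mapping.keys (p_poly n R K) \<subseteq> monomials_upto (n choose 4) (dim2 n)"
proof -
  let ?m = "n choose 4"
  have scalar: "Poly_Mapping.keys (scalar_mpoly r) \<subseteq> monomials_upto ?m d" for r d
    by (simp add: scalar_mpoly_def keys_mconst_monomials_upto)
  have x: "Poly_Mapping.keys (x_mpoly * scalar_mpoly r) \<subseteq> monomials_upto ?m 1" for r
    using keys_mult_monomials_upto[of x_mpoly ?m 0 "scalar_mpoly r" 1] scalar[of r]
    by (simp add: x_mpoly_def keys_mconst_monomials_upto)
  have z: "Poly_Mapping.keys (mvar s * scalar_mpoly r) \<subseteq> monomials_upto ?m 1"
    if "s \<in> {1..?m}" for r s
    using keys_mult_monomials_upto[of "mvar s" ?m 1 "scalar_mpoly r" 0] scalar[of r 0]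
      keys_mvar_monomials_upto[OF that] by simp
  show ?thesis
    unfolding p_poly_def
  proof (rule keys_det_monomials_upto)
    fix i j assume ij: "i < dim2 n" "j < dim2 n"
    show "Poly_Mapping.keys (mat (dim2 n) (dim2 n) (\<lambda>(i, j).
        scalar_mpoly (operator_matrix n R $$ (i, j))
        - x_mpoly * scalar_mpoly (1\<^sub>m (dim2 n) $$ (i, j))
        - (\<Sum>s\<in>{1..?m}. mvar s * scalar_mpoly (operator_matrix n (K s) $$ (i, j)))) $$ (i, j))
        \<subseteq> monomials_upto ?m 1"
      unfolding index_mat(1)[OF ij] case_prod_conv
      by (intro keys_diff_monomials_upto keys_sum_monomials_upto scalar x z)
  qed simp
qed

lemma meval_p_poly:
  "meval (\<lambda>c. poly c x) w (p_poly n R K) = det (hom_pencil n R K x (w(0 := 1)))"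
proof -
  let ?e = "meval (\<lambda>c. poly c x) w"
  interpret comm_ring_hom ?e
    by (rule comm_ring_hom.comm_ring_hom_meval) (rule comm_ring_hom_poly_at)
  have scalar: "?e (scalar_mpoly r) = complex_of_real r" for r
    by (simp add: scalar_mpoly_def mconst_def meval_def)
  have x: "?e x_mpoly = x"
    by (simp add: x_mpoly_def mconst_def meval_def)
  have z: "?e (mvar s) = w s" for s
    by (simp add: mvar_def meval_def)
  show ?thesis
    unfolding p_poly_def hom_det[symmetric]
    by (intro arg_cong[of _ _ det] eq_matI)
      (auto simp: hom_pencil_def hom_distribs scalar x z intro!: sum.cong)
qed

text \<open>
  Scaling by \<open>z\<^sub>0\<close> multiplies a determinant of size \<open>N\<close> by \<open>z\<^sub>0 ^ N\<close>, which is the factor that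
  homogenization in formal degree \<open>N\<close> produces; this settles the points with \<open>z\<^sub>0 \<noteq> 0\<close>. Both
  sides are continuous in \<open>z\<^sub>0\<close>, so that they also agree at \<open>z\<^sub>0 = 0\<close>.
\<close>

lemma meval_homogenization_p_poly:
  "meval id z (homogenization (dim2 n) (Poly_Mapping.map (\<lambda>c. poly c x) (p_poly n R K)))
    = det (hom_pencil n R K x z)"
proof -
  let ?P = "Poly_Mapping.map (\<lambda>c. poly c x) (p_poly n R K)"
  let ?l = "\<lambda>z. meval id z (homogenization (dim2 n) ?P)"
  let ?r = "\<lambda>z. det (hom_pencil n R K x z)"
  have "Poly_Mapping.keys ?P \<subseteq> Poly_Mapping.keys (p_poly n R K)"
    by (rule keys_map_mpolynomial_subset)
  then have deg: "monomial_degree \<alpha> \<le> dim2 n" if "\<alpha> \<in> Poly_Mapping.keys ?P" for \<alpha>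
    using that keys_p_poly[of n R K] by (auto simp: monomials_upto_def)
  have off_infinity: "?l z = ?r z" if z0: "z 0 \<noteq> 0" for z
  proof -
    interpret comm_ring_hom "\<lambda>c. poly c x" by (rule comm_ring_hom_poly_at)
    have "?l z = z 0 ^ dim2 n * det (hom_pencil n R K x ((\<lambda>v. z v / z 0)(0 := 1)))"
      using meval_homogenization_off_infinity[of ?P _ z, OF deg z0]
      unfolding meval_map meval_p_poly .
    also have "\<dots> = det (z 0 \<cdot>\<^sub>m hom_pencil n R K x ((\<lambda>v. z v / z 0)(0 := 1)))"
      by (simp add: hom_pencil_def)
    also have "z 0 \<cdot>\<^sub>m hom_pencil n R K x ((\<lambda>v. z v / z 0)(0 := 1)) = hom_pencil n R K x z"
      using z0 by (intro eq_matI)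
        (auto simp: hom_pencil_def right_diff_distrib sum_distrib_left intro!: sum.cong)
    finally show ?thesis .
  qed
  show ?thesis
  proof (cases "z 0 = 0")
    case True
    have "(\<lambda>t. ?l (z(0 := t))) \<midarrow>0\<rightarrow> ?l (z(0 := 0))"
      using isCont_meval_homogenization by (simp add: isCont_def)
    moreover have "(\<lambda>t. ?l (z(0 := t))) \<midarrow>0\<rightarrow> ?r (z(0 := 0))"
    proof -
      have "isCont (\<lambda>t. hom_pencil n R K x (z(0 := t)) $$ (i, j)) 0"
        if "i < dim2 n" "j < dim2 n" for i j
        using that unfolding hom_pencil_def by simp
      then have "isCont (\<lambda>t. ?r (z(0 := t))) 0"
        by (rule isCont_det[OF hom_pencil_carrier])
      then have "(\<lambda>t. ?r (z(0 := t))) \<midarrow>0\<rightarrow> ?r (z(0 := 0))"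
        by (simp add: isCont_def)
      moreover have "?l (z(0 := t)) = ?r (z(0 := t))" if "t \<noteq> 0" for t
        using off_infinity[of "z(0 := t)"] that by simp
      ultimately show ?thesis
        using LIM_equal[of 0 "\<lambda>t. ?l (z(0 := t))" "\<lambda>t. ?r (z(0 := t))"] by blast
    qed
    ultimately have "?l (z(0 := 0)) = ?r (z(0 := 0))"
      by (rule LIM_unique)
    then show ?thesis
      using True by (metis fun_upd_triv)
  qed (rule off_infinity)
qed


section \<open>A four-form with a large kernel\<close>

text \<open>
  The tensor \<open>12 e\<^sub>0 \<and> e\<^sub>1 \<and> e\<^sub>2 \<and> e\<^sub>3\<close>: the Vandermonde product of the indices is antisymmetric,
  and its value at \<open>(0, 1, 2, 3)\<close> is 12. Writing it as a product makes the antisymmetry a matter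
  of commutative algebra.
\<close>

definition volume4 :: tensor4 where
  "volume4 a b c d = (if a < 4 \<and> b < 4 \<and> c < 4 \<and> d < 4 then
     (real b - real a) * (real c - real a) * (real d - real a)
       * (real c - real b) * (real d - real b) * (real d - real c) else 0)"

lemma volume4_four_form:
  assumes "n \<ge> 4"
  shows "volume4 \<in> four_forms n"
  using assms by (auto simp: four_forms_def tensor4_on_def volume4_def algebra_simps)

lemma volume4_nonzero: "volume4 0 1 2 3 \<noteq> 0"
  by (simp add: volume4_def)

lemma volume4_outside: "volume4 a 4 c d = 0"
  by (simp add: volume4_def)

lemma four_form_coordinates:
  assumes K: "four_form_basis n K" and W: "W \<in> four_forms n"
  obtains c where "\<And>a b d e. W a b d e = (\<Sum>s\<in>{1..n choose 4}. c s * K s a b d e)"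
proof -
  let ?I = "{1..n choose 4}"
  have inj: "inj_on K ?I" and "W \<in> tensor.span (K ` ?I)"
    using K W by (auto simp: four_form_basis_def)
  then obtain u where "W = (\<Sum>v\<in>K ` ?I. (\<lambda>a b d e. u v * v a b d e))"
    using tensor.span_finite[of "K ` ?I"] by auto
  then have W_eq: "W = (\<Sum>s\<in>?I. (\<lambda>a b d e. u (K s) * K s a b d e))"
    by (simp only: sum.reindex[OF inj] o_def)
  have sum_apply: "(\<Sum>s\<in>I. (\<lambda>a b d e. u (K s) * K s a b d e)) a b d e = (\<Sum>s\<in>I. u (K s) * K s a b d e)"
    for I a b d e
    by (induction I rule: infinite_finite_induct) auto
  have "W a b d e = (\<Sum>s\<in>?I. u (K s) * K s a b d e)" for a b d e
    by (subst W_eq) (rule sum_apply)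
  then show ?thesis
    by (rule that)
qed


section \<open>The singular point at infinity\<close>

text \<open>
  The point has \<open>z\<^sub>0 = 0\<close>, and its other coordinates are those of \<^const>\<open>volume4\<close> in the basis
  \<open>K\<close>; it depends neither on \<open>x\<close> nor on \<open>R\<close>. The rows of \<open>e\<^sub>0 \<and> e\<^sub>4\<close> and \<open>e\<^sub>1 \<and> e\<^sub>4\<close> vanish
  there, and this is where the fifth dimension enters.
\<close>

lemma p_poly_singular_point:
  assumes n: "n \<ge> 5" and K: "four_form_basis n K"
  shows "has_singular_point (n choose 4)
    (homogenization (dim2 n) (Poly_Mapping.map (\<lambda>c. poly c x) (p_poly n R K)))"
proof -
  let ?I = "{1..n choose 4}"
  obtain c where c: "\<And>a b d e. volume4 a b d e = (\<Sum>s\<in>?I. c s * K s a b d e)"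
    using four_form_coordinates[OF K volume4_four_form] n by auto
  define z where "z i = (if i \<in> ?I then complex_of_real (c i) else 0)" for i
  have "\<exists>s\<in>?I. c s \<noteq> 0"
  proof (rule ccontr)
    assume "\<not> ?thesis"
    then show False
      using c[of 0 1 2 3] volume4_nonzero by simp
  qed
  then have nonzero: "\<exists>i\<in>{0..n choose 4}. z i \<noteq> 0"
    by (force simp: z_def)
  have K_form: "K s \<in> four_forms n" if "s \<in> ?I" for s
    using K that tensor.span_base[of "K s" "K ` ?I"] by (auto simp: four_form_basis_def)
  \<comment> \<open>At \<open>z\<close> the pencil is the matrix of \<open>- volume4\<close>, since \<open>z\<^sub>0 = 0\<close>.\<close>
  have zero_row: "hom_pencil n R K x z $$ (r, j) = 0"
    if r: "r < dim2 n" "index_pairs n ! r = (a, 4)" and j: "j < dim2 n" for a r j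
  proof -
    obtain d e where de: "index_pairs n ! j = (d, e)"
      by (cases "index_pairs n ! j")
    have "hom_pencil n R K x z $$ (r, j)
        = - (\<Sum>s\<in>?I. complex_of_real (c s * K s a 4 d e))"
      using r j K_form
      by (auto simp: hom_pencil_def z_def operator_matrix_entry[OF _ r(1) j r(2) de] intro!: sum.cong)
    also have "\<dots> = - complex_of_real (volume4 a 4 d e)"
      unfolding c by simp
    finally show ?thesis
      by (simp add: volume4_outside)
  qed
  have "(0, 4) \<in> set (index_pairs n)" "(1, 4) \<in> set (index_pairs n)"
    using n by (auto simp: set_index_pairs)
  then obtain r s where rs: "r < dim2 n" "index_pairs n ! r = (0, 4)"
      "s < dim2 n" "index_pairs n ! s = (1, 4)"
    by (metis in_set_conv_nth length_index_pairs)
  have "((\<lambda>t. det (hom_pencil n R K x (z(i := t)))) has_field_derivative 0) (at (z i))" for i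
  proof (rule has_field_derivative_det_two_zero_rows[OF hom_pencil_carrier _ rs(1,3)])
    show "r \<noteq> s"
      using rs by auto
    show "hom_pencil n R K x (z(i := z i)) $$ (r, j) = 0" if "j < dim2 n" for j
      using zero_row[OF rs(1,2) that] by simp
    show "hom_pencil n R K x (z(i := z i)) $$ (s, j) = 0" if "j < dim2 n" for j
      using zero_row[OF rs(3,4) that] by simp
    have coord: "((\<lambda>t. (z(i := t)) k) has_field_derivative of_bool (k = i)) (at (z i))" for k
      by (cases "k = i") simp_all
    fix k l assume "k < dim2 n" "l < dim2 n"
    show "((\<lambda>t. hom_pencil n R K x (z(i := t)) $$ (k, l)) has_field_derivative
        of_bool (0 = i) * (complex_of_real (operator_matrix n R $$ (k, l))
            - x * 1\<^sub>m (dim2 n) $$ (k, l))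
          - (\<Sum>s\<in>?I. of_bool (s = i) * complex_of_real (operator_matrix n (K s) $$ (k, l))))
        (at (z i))"
      unfolding hom_pencil_def index_mat(1)[OF \<open>k < dim2 n\<close> \<open>l < dim2 n\<close>] case_prod_conv
      by (intro DERIV_diff DERIV_sum DERIV_cmult_right coord)
  qed
  then show ?thesis
    using nonzero unfolding has_singular_point_def meval_homogenization_p_poly by blast
qed

theorem theorem4p2:
  fixes n :: nat
    and R :: tensor4
    and K :: "nat \<Rightarrow> tensor4"
    and D :: "(nat monomial, complex) mpolynomial"
    and q :: "complex poly"
  assumes "n \<ge> 5"
    and "curvature_tensor n R"
    and "four_form_basis n K"
    and "is_discriminant (n choose 4) (dim2 n) D"
    and "q = disc_z D (p_poly n R K)"
  shows "q = 0"
proof -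
  have "poly q x = 0" for x
  proof -
    let ?P = "Poly_Mapping.map (\<lambda>c. poly c x) (p_poly n R K)"
    have "Poly_Mapping.keys ?P \<subseteq> Poly_Mapping.keys (p_poly n R K)"
      by (rule keys_map_mpolynomial_subset)
    then have "Poly_Mapping.keys ?P \<subseteq> monomials_upto (n choose 4) (dim2 n)"
      using keys_p_poly by blast
    then have "meval id (Poly_Mapping.lookup ?P) D = 0"
      using assms(4) p_poly_singular_point[OF assms(1,3)] unfolding is_discriminant_def by blast
    then show ?thesis
      by (simp add: assms(5) poly_disc_z)
  qed
  then show ?thesis
    using poly_all_0_iff_0 by blast
qed

end
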